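(* Let $n\ge 3$ be an integer. Let $Fix_D$ denote the set of the fixed points of the self map ${\rm dav}_{fc}:\mathbf{Z}^n\to\mathbf{Z}^n$, and let $Per_D$ denote the set of periodic points under ${\rm dav}_{fc}$. Then $Fix_D$ consists of the following two types of elements $\mathbf{d}=(d_0,\dots,d_{n-1})$: (1) $w(\mathbf{d})=0$; (2) $w(\mathbf{d})=1$ and $d_i\in\{m,m+1\}$ for any $i$, with $m$ even; and $Per_D$ consists of the following elements: (3) $w(\mathbf{d})=1$ and $d_i\in\{m,m+1\}$ for any $i$, with $m$ odd. The period of the elements of type (3) is equal to $n$. Furthermore, for any $\mathbf{d}\in\mathbf{Z}^n\setminus(Fix_D\cup Per_D)$, there exists a positive integer $k$ such that ${\rm dav}_{fc}^k(\mathbf{d})\in Fix_D\cup Per_D$.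
   Context: For $a,b\in\mathbf{Z}$ put $av_{fc}(a,b)=\lfloor\frac{a+b}{2}\rfloor$ if $a$ is even and $av_{fc}(a,b)=\lceil\frac{a+b}{2}\rceil$ if $a$ is odd. For $\mathbf{d}=(d_0,\dots,d_{n-1})\in\mathbf{Z}^n$ put ${\rm dav}_{fc}(\mathbf{d})=(av_{fc}(d_0,d_1),av_{fc}(d_1,d_2),\dots,av_{fc}(d_{n-1},d_0))$; its $k$-fold iterate is written ${\rm dav}_{fc}^k$. The width of $\mathbf{d}$ is $w(\mathbf{d})=\max(\mathbf{d})-\min(\mathbf{d})$, the difference of the largest and smallest entries. In (2) and (3), $m$ is an integer.
   Formalization: Per_D means periodic points that are not fixed. "The period is equal to n" is read as: n is a period of every type (3) element and the least period of some; least period n for every element is false for composite n (n=4, (1,2,1,2) has least period 2). *)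

theory Defs
  imports Complex_Main
begin

definition av_fc :: "int \<Rightarrow> int \<Rightarrow> int" where
  "av_fc a b = (if even a then \<lfloor>real_of_int (a + b) / 2\<rfloor> else \<lceil>real_of_int (a + b) / 2\<rceil>)"

definition Zn :: "nat \<Rightarrow> int list set" where
  "Zn n = {d. length d = n}"

definition dav_fc :: "int list \<Rightarrow> int list" where
  "dav_fc d = map (\<lambda>i. av_fc (d ! i) (d ! (Suc i mod length d))) [0..<length d]"

definition width :: "int list \<Rightarrow> int" where
  "width d = Max (set d) - Min (set d)"

definition Fix_D :: "nat \<Rightarrow> int list set" where
  "Fix_D n = {d \<in> Zn n. dav_fc d = d}"

text \<open>Fixed points are excluded from the periodic points: \<^term>\<open>Fix_D n\<close> and \<open>Per_D n\<close>
  are meant to be complementary parts of the set of all recurrent vectors.\<close>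

definition Per_D :: "nat \<Rightarrow> int list set" where
  "Per_D n = {d \<in> Zn n. dav_fc d \<noteq> d \<and> (\<exists>p>0. (dav_fc ^^ p) d = d)}"

text \<open>The least period; only meaningful when some positive iterate returns to \<open>d\<close>.
  A type (3) vector is cyclically shifted by \<^const>\<open>dav_fc\<close>, so one with a rotational symmetry, such as
  \<open>[1, 2, 1, 2]\<close>, has least period smaller than its length: the length is a period of every type (3)
  vector, but the least period only of some.\<close>

definition min_period :: "int list \<Rightarrow> nat" where
  "min_period d = (LEAST p. 0 < p \<and> (dav_fc ^^ p) d = d)"

definition type1 :: "nat \<Rightarrow> int list set" where
  "type1 n = {d \<in> Zn n. width d = 0}"

definition type2 :: "nat \<Rightarrow> int list set" where
  "type2 n = {d \<in> Zn n. width d = 1 \<and> (\<exists>m::int. even m \<and> (\<forall>i<n. d ! i \<in> {m, m + 1}))}"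

definition type3 :: "nat \<Rightarrow> int list set" where
  "type3 n = {d \<in> Zn n. width d = 1 \<and> (\<exists>m::int. odd m \<and> (\<forall>i<n. d ! i \<in> {m, m + 1}))}"

end

(* Since av_fc a b = ceiling (a/2) + floor (b/2), the map does not increase the sum of the squares
   of the entries. If n consecutive steps leave this sum unchanged, then along them every position
   keeps its value ceiling (d_i/2), while the sequence of the values floor (d_i/2) is rotated. Hence
   ceiling (d_i/2) - floor (d_j/2) is 0 or 1 for all i, j, and so the width is at most 1. *)
theory Submission
  imports Defs
begin

section \<open>Rounded halves and cyclic sums\<close>

text \<open>For even \<open>a\<close>, the half \<open>a / 2\<close> is an integer, so rounding down
  acts on \<open>b / 2\<close> alone. For odd \<open>a\<close>, the integer
  \<open>(a + 1) / 2\<close> splits off, and rounding up \<open>(b - 1) / 2\<close> gives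
  \<open>b div 2\<close>.\<close>

lemma av_fc_eq: "av_fc a b = (a + 1) div 2 + b div 2"
proof -
  have "\<lceil>real_of_int (a + b) / 2\<rceil> = - (- (a + b) div 2)"
    using ceiling_divide_eq_div[of "a + b" 2] by simp
  moreover have "\<lfloor>real_of_int (a + b) / 2\<rfloor> = (a + b) div 2"
    using floor_divide_of_int_eq[of "a + b" 2] by simp
  ultimately show ?thesis
    unfolding av_fc_def by presburger
qed

lemma length_dav_fc [simp]: "length (dav_fc d) = length d"
  by (simp add: dav_fc_def)

lemma length_dav_fc_funpow [simp]: "length ((dav_fc ^^ k) d) = length d"
  by (induction k) auto

lemma nth_dav_fc:
  "i < length d \<Longrightarrow> dav_fc d ! i = (d ! i + 1) div 2 + d ! (Suc i mod length d) div 2"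
  by (simp add: dav_fc_def av_fc_eq)

text \<open>The cyclic successor permutes the indices. This is what makes differences between
  neighbours cancel around the cycle.\<close>

lemma sum_Suc_mod:
  fixes g :: "nat \<Rightarrow> 'a::comm_monoid_add"
  shows "(\<Sum>i<n. g (Suc i mod n)) = (\<Sum>i<n. g i)"
proof (cases n)
  case (Suc m)
  have "(\<Sum>i<m. g (Suc i mod Suc m)) = (\<Sum>i<m. g (Suc i))"
    by (intro sum.cong) auto
  then have "(\<Sum>i<Suc m. g (Suc i mod Suc m)) = (\<Sum>i<m. g (Suc i)) + g 0"
    by simp
  also have "\<dots> = (\<Sum>i<Suc m. g i)"
    by (simp add: sum.lessThan_Suc_shift add.commute del: sum.lessThan_Suc)
  finally show ?thesis
    using Suc by simp
qed simp

section \<open>Monotonicity of the energy and its equality case\<close>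

definition energy :: "int list \<Rightarrow> int" where
  "energy d = (\<Sum>i<length d. (d ! i)\<^sup>2)"

text \<open>A single square can grow under the map, as for the neighbours 0 and 2, where 0 becomes
  1. The difference of potentials compensates for this position by position.\<close>

definition potential :: "int \<Rightarrow> int" where
  "potential f = 2 * f\<^sup>2 + f"

lemma int_mult_pred_nonneg: "0 \<le> t * (t - 1)" for t :: int
  by (cases "t \<le> 0") (auto intro: mult_nonpos_nonpos)

text \<open>With \<open>p\<close> the parity of \<open>x\<close> and \<open>t = x div 2 - y div 2\<close>, the two sides differ by
  \<open>t\<^sup>2 - t + 2 * p * t\<close>, a product of two consecutive integers.\<close>

lemma av_energy_step:
  fixes x y :: int
  defines "z \<equiv> (x + 1) div 2 + y div 2"
  shows "z\<^sup>2 + potential (x div 2) - potential (y div 2) \<le> x\<^sup>2" (is ?le)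
    and "z\<^sup>2 + potential (x div 2) - potential (y div 2) = x\<^sup>2 \<Longrightarrow>
      (z + 1) div 2 = (x + 1) div 2 \<and> z div 2 = y div 2" (is "?eq \<Longrightarrow> ?concl")
proof -
  define f g where "f = x div 2" and "g = y div 2"
  have "?le \<and> (?eq \<longrightarrow> ?concl)"
  proof (cases "even x")
    case True
    then have x: "x = 2 * f" and z: "z = f + g"
      by (auto simp: f_def g_def z_def)
    have diff: "x\<^sup>2 - (z\<^sup>2 + potential f - potential g) = (f - g) * (f - g - 1)"
      unfolding x z potential_def by (simp add: power2_eq_square algebra_simps)
    have ?concl if ?eq
    proof -
      \<comment> \<open>A product of two consecutive integers vanishes, so \<open>z\<close> is
        \<open>2 * g\<close> or \<open>2 * g + 1\<close>; both rounded halves of \<open>z\<close>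
        can then be read off.\<close>
      have "f - g = 0 \<or> f - g = 1"
        using diff that by (auto simp: f_def g_def)
      then show ?thesis
        unfolding g_def[symmetric] using x z by auto
    qed
    then show ?thesis
      using diff int_mult_pred_nonneg[of "f - g"] by (simp add: f_def g_def)
  next
    case False
    then have x: "x = 2 * f + 1"
      by (simp add: f_def)
    then have z: "z = f + 1 + g"
      by (simp add: g_def z_def)
    have diff: "x\<^sup>2 - (z\<^sup>2 + potential f - potential g) = (g - f) * (g - f - 1)"
      unfolding x z potential_def by (simp add: power2_eq_square algebra_simps)
    have ?concl if ?eq
    proof -
      have "g - f = 0 \<or> g - f = 1"
        using diff that by (auto simp: f_def g_def)
      then show ?thesis
        unfolding g_def[symmetric] using x z by auto
    qed
    then show ?thesis
      using diff int_mult_pred_nonneg[of "g - f"] by (simp add: f_def g_def)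
  qed
  then show ?le and "?eq \<Longrightarrow> ?concl"
    by blast+
qed

text \<open>The potential differences cancel over the cycle; adding them changes no total but allows
  a comparison of summands.\<close>

lemma energy_dav_fc:
  "energy (dav_fc d) = (\<Sum>i<length d. (dav_fc d ! i)\<^sup>2 + potential (d ! i div 2)
     - potential (d ! (Suc i mod length d) div 2))"
  using sum_Suc_mod[of "\<lambda>i. potential (d ! i div 2)" "length d"]
  by (simp add: energy_def sum.distrib sum_subtractf)

lemma energy_dav_fc_le: "energy (dav_fc d) \<le> energy d"
  unfolding energy_dav_fc unfolding energy_def
  by (intro sum_mono) (use av_energy_step(1) nth_dav_fc in auto)

text \<open>Equal sums with summandwise inequality force equality at every position, so the equality
  case of \<open>av_energy_step\<close> applies everywhere.\<close>

lemma energy_dav_fc_eqD: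
  assumes "energy (dav_fc d) = energy d" and i: "i < length d"
  shows "(dav_fc d ! i + 1) div 2 = (d ! i + 1) div 2"
    and "dav_fc d ! i div 2 = d ! (Suc i mod length d) div 2"
proof -
  have "(dav_fc d ! i)\<^sup>2 + potential (d ! i div 2) - potential (d ! (Suc i mod length d) div 2)
      = (d ! i)\<^sup>2"
    by (rule sum_mono_inv[OF assms(1)[unfolded energy_dav_fc, unfolded energy_def]])
      (use av_energy_step(1) nth_dav_fc i in auto)
  then show "(dav_fc d ! i + 1) div 2 = (d ! i + 1) div 2"
    and "dav_fc d ! i div 2 = d ! (Suc i mod length d) div 2"
    using av_energy_step(2)[of "d ! i" "d ! (Suc i mod length d)"] nth_dav_fc[OF i] by auto
qed

lemma energy_nonneg: "0 \<le> energy d"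
  by (simp add: energy_def sum_nonneg)

lemma energy_funpow_antimono: "j \<le> k \<Longrightarrow> energy ((dav_fc ^^ k) d) \<le> energy ((dav_fc ^^ j) d)"
  by (rule lift_Suc_antimono_le) (auto intro: energy_dav_fc_le)

text \<open>The equality case is iterated: each step fixes the upper halves in place and moves the
  lower halves one position to the left.\<close>

lemma halves_funpow:
  assumes eq: "energy d \<le> energy ((dav_fc ^^ n) d)" and "k \<le> n" and "i < length d"
  shows "((dav_fc ^^ k) d ! i + 1) div 2 = (d ! i + 1) div 2
    \<and> (dav_fc ^^ k) d ! i div 2 = d ! ((i + k) mod length d) div 2"
  using assms(2,3)
proof (induction k arbitrary: i)
  case (Suc k)
  let ?e = "(dav_fc ^^ k) d"
  let ?j = "Suc i mod length d"
  \<comment> \<open>Energy never grows and is not lost within \<open>n\<close> steps, so it is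
    constant along the first \<open>n\<close> steps.\<close>
  have "energy d \<le> energy (dav_fc ?e)"
    using energy_funpow_antimono[OF Suc.prems(1), of d] eq by simp
  moreover have "energy ?e \<le> energy d"
    using energy_funpow_antimono[of 0 k d] by simp
  ultimately have E: "energy (dav_fc ?e) = energy ?e"
    using energy_dav_fc_le[of ?e] by linarith
  have j: "?j < length d"
    using Suc.prems(2) by (intro mod_less_divisor) auto
  have "(?j + k) mod length d = (i + Suc k) mod length d"
    by (simp add: mod_add_left_eq)
  moreover have "(?e ! i + 1) div 2 = (d ! i + 1) div 2"
    using Suc.IH[of i] Suc.prems by simp
  moreover have "?e ! ?j div 2 = d ! ((?j + k) mod length d) div 2"
    using Suc.IH[OF _ j] Suc.prems by simp
  moreover have "(dav_fc ?e ! i + 1) div 2 = (?e ! i + 1) div 2" "dav_fc ?e ! i div 2 = ?e ! ?j div 2"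
    using energy_dav_fc_eqD[OF E, of i] Suc.prems by simp_all
  ultimately show ?case
    by (simp only: funpow.simps comp_apply)
qed simp

section \<open>Stable energy bounds the width\<close>

lemma width_le_iff:
  assumes "d \<noteq> []"
  shows "width d \<le> w \<longleftrightarrow> (\<forall>x\<in>set d. \<forall>y\<in>set d. x - y \<le> w)"
proof
  assume w: "width d \<le> w"
  show "\<forall>x\<in>set d. \<forall>y\<in>set d. x - y \<le> w"
  proof (intro ballI)
    fix x y
    assume "x \<in> set d" "y \<in> set d"
    then have "x \<le> Max (set d)" "Min (set d) \<le> y"
      by auto
    then show "x - y \<le> w"
      using w unfolding width_def by linarith
  qed
next
  assume "\<forall>x\<in>set d. \<forall>y\<in>set d. x - y \<le> w"
  moreover have "Max (set d) \<in> set d" "Min (set d) \<in> set d"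
    using assms by auto
  ultimately show "width d \<le> w"
    unfolding width_def by blast
qed

lemma width_nonneg: "d \<noteq> [] \<Longrightarrow> 0 \<le> width d"
  by (simp add: width_def)

lemma width_le_1_if_energy_stable:
  assumes ne: "d \<noteq> []" and eq: "energy d \<le> energy ((dav_fc ^^ length d) d)"
  shows "width d \<le> 1"
proof -
  let ?n = "length d"
  have n: "0 < ?n"
    using ne by simp
  have halves: "d ! j div 2 \<le> (d ! i + 1) div 2 \<and> (d ! i + 1) div 2 \<le> d ! j div 2 + 1"
    if "i < ?n" "j < ?n" for i j
  proof -
    \<comment> \<open>After \<open>k\<close> steps the lower half from position \<open>j\<close> has
      arrived at position \<open>i\<close>. Adding \<open>?n\<close> keeps the natural subtraction
      from truncating.\<close>
    define k where "k = (j + ?n - i) mod ?n"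
    have k: "k \<le> ?n" "(i + k) mod ?n = j"
      using that n by (auto simp: k_def mod_add_right_eq intro: less_imp_le)
    define z where "z = (dav_fc ^^ k) d ! i"
    have "(z + 1) div 2 = (d ! i + 1) div 2" "z div 2 = d ! j div 2"
      using halves_funpow[OF eq k(1) that(1)] k(2) by (auto simp: z_def)
    then show ?thesis
      by linarith
  qed
  \<comment> \<open>Each entry is the sum of its upper and lower half. The upper half of
    \<open>d ! i\<close> exceeds the lower half of \<open>d ! j\<close> by at most 1, and the lower
    half of \<open>d ! i\<close> is at most the upper half of \<open>d ! j\<close>.\<close>
  have "d ! i - d ! j \<le> 1" if "i < ?n" "j < ?n" for i j
    using halves[OF that] halves[OF that(2,1)] by presburger
  then show ?thesis
    unfolding width_le_iff[OF ne] by (metis in_set_conv_nth)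
qed

lemma width_le_1_if_periodic:
  assumes "d \<noteq> []" and p: "0 < p" "(dav_fc ^^ p) d = d"
  shows "width d \<le> 1"
proof -
  have iter: "(dav_fc ^^ (p * k)) d = d" for k
    by (induction k) (simp_all add: funpow_add p(2))
  \<comment> \<open>The period \<open>p\<close> may be shorter than the vector; this multiple of it
    covers the \<open>length d\<close> steps that stability requires.\<close>
  have "length d \<le> p * length d"
    using p(1) by simp
  then have "energy d \<le> energy ((dav_fc ^^ length d) d)"
    using energy_funpow_antimono iter by metis
  then show ?thesis
    using assms(1) by (rule width_le_1_if_energy_stable[rotated])
qed

text \<open>Each block of \<open>length d\<close> steps either starts at width at most 1 or strictly
  lowers the energy, a nonnegative integer.\<close>

lemma eventually_width_le_1:
  assumes "d \<noteq> []"
  shows "\<exists>k. width ((dav_fc ^^ k) d) \<le> 1"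
  using assms
proof (induction d rule: measure_induct_rule[of "\<lambda>d. nat (energy d)"])
  case (less d)
  let ?e = "(dav_fc ^^ length d) d"
  show ?case
  proof (cases "energy d \<le> energy ?e")
    case True
    then have "width ((dav_fc ^^ 0) d) \<le> 1"
      using width_le_1_if_energy_stable[OF less.prems] by simp
    then show ?thesis ..
  next
    case False
    then have "nat (energy ?e) < nat (energy d)"
      using energy_nonneg[of ?e] by linarith
    moreover have "?e \<noteq> []"
      using less.prems by (metis length_dav_fc_funpow length_0_conv)
    ultimately obtain k where "width ((dav_fc ^^ k) ?e) \<le> 1"
      using less.IH by blast
    then have "width ((dav_fc ^^ (k + length d)) d) \<le> 1"
      by (simp add: funpow_add)
    then show ?thesis ..
  qed
qed

section \<open>The action on vectors of width at most one\<close>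

lemma width_le_1_cases:
  assumes d: "d \<in> Zn n" and "0 < n" and w: "width d \<le> 1"
  shows "d \<in> type1 n \<union> type2 n \<union> type3 n"
proof (cases "width d = 0")
  case True
  then show ?thesis
    using d by (simp add: type1_def)
next
  case False
  have ne: "d \<noteq> []" and len: "length d = n"
    using d \<open>0 < n\<close> by (auto simp: Zn_def)
  have w1: "width d = 1"
    using False w width_nonneg[OF ne] by linarith
  define m where "m = Min (set d)"
  have "d ! i \<in> {m, m + 1}" if "i < n" for i
  proof -
    have "d ! i \<in> set d"
      using that len by simp
    then have "m \<le> d ! i" "d ! i \<le> Max (set d)"
      by (auto simp: m_def)
    then show ?thesis
      using w1 unfolding width_def m_def by auto
  qed
  then show ?thesis
    using d w1 by (cases "even m") (auto simp: type2_def type3_def)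
qed

lemma type1_fixed:
  assumes "d \<in> type1 n"
  shows "dav_fc d = d"
proof (cases "d = []")
  case True
  then show ?thesis
    by (simp add: dav_fc_def)
next
  case False
  have "d ! i = d ! j" if "i < length d" "j < length d" for i j
  proof -
    have "\<forall>x\<in>set d. \<forall>y\<in>set d. x - y \<le> 0"
      using assms width_le_iff[OF False, of 0] by (simp add: type1_def)
    then have "d ! i - d ! j \<le> 0" "d ! j - d ! i \<le> 0"
      using that nth_mem by blast+
    then show ?thesis
      by linarith
  qed
  moreover have "Suc i mod length d < length d" for i
    using False by simp
  ultimately have "dav_fc d ! i = (d ! i + 1) div 2 + d ! i div 2" if "i < length d" for i
    using nth_dav_fc[OF that] that by metis
  then have "dav_fc d ! i = d ! i" if "i < length d" for i
    using that by presburger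
  then show ?thesis
    by (intro nth_equalityI) auto
qed

text \<open>For even \<open>m\<close>, both \<open>m\<close> and \<open>m + 1\<close> have lower
  half \<open>m div 2\<close>, so the right neighbour has no influence on the result.\<close>

lemma type2_fixed:
  assumes "d \<in> type2 n"
  shows "dav_fc d = d"
proof (rule nth_equalityI)
  obtain m where m: "even m" "\<forall>i<n. d ! i \<in> {m, m + 1}" and len: "length d = n"
    using assms by (auto simp: type2_def Zn_def)
  fix i
  assume "i < length (dav_fc d)"
  then have i: "i < n"
    using len by simp
  then have "Suc i mod n < n"
    by (intro mod_less_divisor) auto
  then have "d ! i \<in> {m, m + 1}" "d ! (Suc i mod n) \<in> {m, m + 1}"
    using m(2) i by blast+
  then show "dav_fc d ! i = d ! i"
    using nth_dav_fc[of i d] i len m(1) by auto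
qed simp

text \<open>For odd \<open>m\<close>, both values have the same upper half
  \<open>(m + 1) div 2\<close>; adding the lower half of the right neighbour reproduces that
  neighbour.\<close>

lemma dav_fc_eq_rotate1:
  assumes "odd m" "set d \<subseteq> {m, m + 1}"
  shows "dav_fc d = rotate1 d"
proof (rule nth_equalityI)
  fix i
  assume "i < length (dav_fc d)"
  then have i: "i < length d"
    by simp
  then have "Suc i mod length d < length d"
    by (intro mod_less_divisor) auto
  then have "d ! i \<in> {m, m + 1}" "d ! (Suc i mod length d) \<in> {m, m + 1}"
    using assms(2) i nth_mem by blast+
  then show "dav_fc d ! i = rotate1 d ! i"
    using nth_dav_fc[OF i] i assms(1) by (auto simp: nth_rotate1 elim!: oddE)
qed simp

lemma dav_fc_funpow_eq_rotate:
  assumes "odd m" "set d \<subseteq> {m, m + 1}"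
  shows "(dav_fc ^^ k) d = rotate k d"
  by (induction k) (use assms in \<open>simp_all add: dav_fc_eq_rotate1\<close>)

lemma type3_obtain:
  assumes "d \<in> type3 n"
  obtains m where "odd m" "set d \<subseteq> {m, m + 1}" "length d = n" "width d = 1"
proof -
  obtain m where "odd m" "\<forall>i<n. d ! i \<in> {m, m + 1}" "length d = n" "width d = 1"
    using assms by (auto simp: type3_def Zn_def)
  moreover from this have "set d \<subseteq> {m, m + 1}"
    by (metis in_set_conv_nth subsetI)
  ultimately show ?thesis
    using that by blast
qed

lemma type3_funpow: "d \<in> type3 n \<Longrightarrow> (dav_fc ^^ n) d = d"
  by (elim type3_obtain) (simp add: dav_fc_funpow_eq_rotate)

lemma type3_not_fixed:
  assumes "d \<in> type3 n" "0 < n"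
  shows "dav_fc d \<noteq> d"
proof
  obtain m where m: "odd m" "set d \<subseteq> {m, m + 1}" "length d = n" "width d = 1"
    using assms(1) by (rule type3_obtain)
  assume "dav_fc d = d"
  then have "rotate1 d = d"
    using dav_fc_eq_rotate1[OF m(1,2)] by simp
  \<comment> \<open>A vector invariant under rotation by one place is constant, which width 1
    excludes.\<close>
  then have "card (set d) = 1"
    using rotate1_fixpoint_card[of d] m(3) assms(2) by auto
  then obtain a where "set d = {a}"
    using card_1_singletonE by blast
  then have "width d = 0"
    by (simp add: width_def)
  with m(4) show False
    by simp
qed

lemma type3_full_period:
  assumes "2 \<le> n"
  shows "\<exists>d\<in>type3 n. min_period d = n"
proof
  \<comment> \<open>Here \<open>m = 1\<close>, and the single entry 2 rules out any rotational
    symmetry.\<close>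
  define d :: "int list" where "d = 2 # replicate (n - 1) 1"
  have len: "length d = n" and s: "set d = {1, 2}"
    using assms by (auto simp: d_def)
  have nth: "d ! i \<in> {1, 1 + 1}" if "i < n" for i
    using that len s nth_mem[of i d] by auto
  have "width d = 1"
    by (simp add: width_def s)
  then show d3: "d \<in> type3 n"
    unfolding type3_def Zn_def using len nth odd_one by blast
  show "min_period d = n"
    unfolding min_period_def
  proof (rule Least_equality)
    show "0 < n \<and> (dav_fc ^^ n) d = d"
      using assms type3_funpow[OF d3] by simp
  next
    fix p
    assume p: "0 < p \<and> (dav_fc ^^ p) d = d"
    have "rotate p d = d"
      using dav_fc_funpow_eq_rotate[of 1 d p] s p by auto
    then have "d ! (p mod n) = d ! 0"
      using nth_rotate[of 0 d p] len assms by simp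
    moreover have "p mod n < n"
      using assms by simp
    \<comment> \<open>The entry 2 occurs only at position 0.\<close>
    ultimately have "p mod n = 0"
      by (cases "p mod n") (auto simp: d_def)
    then show "n \<le> p"
      using p by (auto intro: dvd_imp_le)
  qed
qed

section \<open>Classification of recurrent vectors and eventual recurrence\<close>

theorem theorem8p1:
  fixes n :: nat
  assumes "n \<ge> 3"
  shows "Fix_D n = type1 n \<union> type2 n
    \<and> Per_D n = type3 n
    \<and> (\<forall>d\<in>type3 n. (dav_fc ^^ n) d = d)
    \<and> (\<exists>d\<in>type3 n. min_period d = n)
    \<and> (\<forall>d \<in> Zn n - (Fix_D n \<union> Per_D n). \<exists>k>0. (dav_fc ^^ k) d \<in> Fix_D n \<union> Per_D n)"
proof -
  have n: "0 < n"
    using assms by simp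
  have ne: "d \<noteq> []" if "d \<in> Zn n" for d
    using that n by (auto simp: Zn_def)
  have Zn: "type1 n \<subseteq> Zn n" "type2 n \<subseteq> Zn n" "type3 n \<subseteq> Zn n"
    by (auto simp: type1_def type2_def type3_def)
  \<comment> \<open>Fixed points are covered as the case \<open>p = 1\<close>, so one width bound
    serves both classifications.\<close>
  have recurrent: "d \<in> type1 n \<union> type2 n \<union> type3 n"
    if "d \<in> Zn n" "0 < p" "(dav_fc ^^ p) d = d" for d p
    using width_le_1_cases[OF that(1) n] width_le_1_if_periodic[OF ne that(2,3)] that(1) by blast
  have Fix: "Fix_D n = type1 n \<union> type2 n"
  proof
    show "Fix_D n \<subseteq> type1 n \<union> type2 n"
    proof
      fix d
      assume "d \<in> Fix_D n"
      then have d: "d \<in> Zn n" "dav_fc d = d"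
        by (auto simp: Fix_D_def)
      then have "d \<in> type1 n \<union> type2 n \<union> type3 n"
        by (intro recurrent[of d 1]) simp_all
      then show "d \<in> type1 n \<union> type2 n"
        using type3_not_fixed[OF _ n] d(2) by blast
    qed
    show "type1 n \<union> type2 n \<subseteq> Fix_D n"
      using Zn type1_fixed type2_fixed by (auto simp: Fix_D_def)
  qed
  have Per: "Per_D n = type3 n"
  proof
    show "Per_D n \<subseteq> type3 n"
      unfolding Per_D_def using recurrent type1_fixed type2_fixed by blast
    show "type3 n \<subseteq> Per_D n"
      unfolding Per_D_def using Zn(3) type3_not_fixed[OF _ n] type3_funpow n by blast
  qed
  have "\<exists>k>0. (dav_fc ^^ k) d \<in> Fix_D n \<union> Per_D n" if d: "d \<in> Zn n - (Fix_D n \<union> Per_D n)" for d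
  proof -
    obtain k where k: "width ((dav_fc ^^ k) d) \<le> 1"
      using eventually_width_le_1 ne d by blast
    have "(dav_fc ^^ k) d \<in> Zn n"
      using d by (simp add: Zn_def)
    then have mem: "(dav_fc ^^ k) d \<in> Fix_D n \<union> Per_D n"
      using width_le_1_cases[OF _ n k] Fix Per by blast
    \<comment> \<open>The start \<open>d\<close> itself lies outside the recurrent set.\<close>
    with d have "k \<noteq> 0"
      by (cases k) auto
    with mem show ?thesis
      by blast
  qed
  then show ?thesis
    using Fix Per type3_funpow type3_full_period[of n] assms by auto
qed

end
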